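(* For each $n_1\geq n_2\geq n_3\geq 2$ it holds \[\mathrm{qc}(n_1, n_2, n_3) \geq \frac{1}{2} \big( n_2 - 1 \big) n_3 \left( \log_2 \frac{n_1 - 1}{n_2 - 1} + 1 \right).\]
   Context: Search game on the grid $S_1\times\cdots\times S_d$ with $S_i=\{0,\ldots,n_i-1\}$: Adversary fixes a target $t$; Algorithm queries a point $q$; if $q\neq t$, Adversary answers for every coordinate $i$ one of $t_i<q_i$ or $t_i>q_i$, at least one of these $d$ inequalities being true, and Algorithm does not learn which one. $\mathrm{qc}(n_1,\ldots,n_d)$ denotes the minimum number of queries that guarantees finding the target (the query complexity). Here $d=3$. *)

theory Defs
  imports Complex_Main
begin

type_synonym point = "nat list"

definition grid :: "nat list \<Rightarrow> point set" where
  "grid ns = {p. length p = length ns \<and> (\<forall>i<length ns. p ! i < ns ! i)}"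

text \<open>For a query \<open>q\<close>, the answer \<open>Less\<close> in coordinate \<open>i\<close> is the claim that the target satisfies
  \<open>t ! i < q ! i\<close>, and \<open>Greater\<close> the claim \<open>t ! i > q ! i\<close>. Both are false if \<open>t ! i = q ! i\<close>.\<close>

datatype answer = Less | Greater

fun claim_true :: "answer \<Rightarrow> nat \<Rightarrow> nat \<Rightarrow> bool" where
  "claim_true Less x y \<longleftrightarrow> x < y"
| "claim_true Greater x y \<longleftrightarrow> x > y"

definition legal_response :: "point \<Rightarrow> point \<Rightarrow> answer list \<Rightarrow> bool" where
  "legal_response t q a \<longleftrightarrow>
     length a = length q \<and> (\<exists>i<length q. claim_true (a ! i) (t ! i) (q ! i))"

text \<open>A strategy of Algorithm maps the responses received so far, in chronological order, to the
  next query; the earlier queries need not be recorded, as the responses determine them.\<close>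

type_synonym strategy = "answer list list \<Rightarrow> point"

definition query :: "strategy \<Rightarrow> (nat \<Rightarrow> answer list) \<Rightarrow> nat \<Rightarrow> point" where
  "query \<sigma> r j = \<sigma> (map r [0..<j])"

text \<open>The game is over as soon as the target is queried. The response sequence \<open>r\<close> is infinite only
  for convenience: its values from that moment on are irrelevant.\<close>

definition legal_play :: "strategy \<Rightarrow> point \<Rightarrow> (nat \<Rightarrow> answer list) \<Rightarrow> bool" where
  "legal_play \<sigma> t r \<longleftrightarrow> (\<forall>j. query \<sigma> r j \<noteq> t \<longrightarrow> legal_response t (query \<sigma> r j) (r j))"

definition finds_within :: "nat list \<Rightarrow> strategy \<Rightarrow> nat \<Rightarrow> bool" where
  "finds_within ns \<sigma> k \<longleftrightarrow>
     (\<forall>t\<in>grid ns. \<forall>r. legal_play \<sigma> t r \<longrightarrow> (\<exists>j<k. query \<sigma> r j = t))"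

definition qc :: "nat list \<Rightarrow> nat" where
  "qc ns = (LEAST k. \<exists>\<sigma>. (\<forall>h. \<sigma> h \<in> grid ns) \<and> finds_within ns \<sigma> k)"

lemma finite_grid: "finite (grid ns)"
proof -
  let ?B = "{p. set p \<subseteq> {..sum_list ns} \<and> length p = length ns}"
  have "p \<in> ?B" if p: "p \<in> grid ns" for p
  proof -
    have "p ! i \<le> sum_list ns" if i: "i < length ns" for i
    proof -
      have "p ! i < ns ! i" using p i by (simp add: grid_def)
      also have "ns ! i \<le> sum_list ns" by (rule elem_le_sum_list[OF i])
      finally show ?thesis by simp
    qed
    moreover have "length p = length ns" using p by (simp add: grid_def)
    ultimately show ?thesis by (simp add: set_conv_nth subset_iff) metis
  qed
  then have "grid ns \<subseteq> ?B" by blast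
  moreover have "finite ?B" using finite_lists_length_eq[of "{..sum_list ns}" "length ns"] by simp
  ultimately show ?thesis by (rule finite_subset)
qed

text \<open>The minimum in \<open>qc\<close> is attained: querying all grid points one after another succeeds.\<close>

lemma qc_attained:
  assumes "\<forall>n\<in>set ns. n > 0"
  shows "\<exists>\<sigma>. (\<forall>h. \<sigma> h \<in> grid ns) \<and> finds_within ns \<sigma> (qc ns)"
proof -
  obtain xs where xs: "set xs = grid ns" using finite_list[OF finite_grid] by blast
  have z: "replicate (length ns) 0 \<in> grid ns" using assms by (auto simp: grid_def)
  define \<sigma> :: strategy where
    "\<sigma> = (\<lambda>h. if length h < length xs then xs ! length h else replicate (length ns) 0)"
  have "\<forall>h. \<sigma> h \<in> grid ns" using xs z nth_mem[of _ xs] by (simp add: \<sigma>_def)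
  moreover have "finds_within ns \<sigma> (length xs)"
    unfolding finds_within_def
  proof (intro ballI allI impI)
    fix t r assume "t \<in> grid ns"
    then obtain j where j: "j < length xs" "xs ! j = t" using xs by (metis in_set_conv_nth)
    then have "query \<sigma> r j = t" by (simp add: query_def \<sigma>_def)
    with j show "\<exists>j<length xs. query \<sigma> r j = t" by blast
  qed
  ultimately have "\<exists>\<sigma>. (\<forall>h. \<sigma> h \<in> grid ns) \<and> finds_within ns \<sigma> (length xs)" by blast
  then show ?thesis unfolding qc_def by (rule LeastI)
qed

end

theory Submission imports Defs begin

text \<open>Adversary assigns to each row \<open>(\<cdot>, a, b)\<close> an interval of first coordinates that depends only on
  \<open>a + b\<close> and moves to the right as \<open>a + b\<close> grows. A query \<open>(x, a, b)\<close> can then be answered so that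
  only candidates of row \<open>(a, b)\<close> are lost: either those \<open>\<le> x\<close>, excluding the orthant of larger
  \<open>a\<close>, \<open>b\<close>, or those \<open>\<ge> x\<close>, excluding the orthant of smaller \<open>a\<close>, \<open>b\<close>. So the rows are independent
  binary searches, and their costs add up. If \<open>n\<^sub>1 - 1 \<ge> 4 (n\<^sub>2 - 1)\<close>, (almost) all intervals get
  as length the same power of two; otherwise the lengths are 0 or 1, respectively 1 or 2, with the
  larger value on the longest diagonals \<open>a + b = const\<close>.\<close>

section \<open>Extending finite plays\<close>

lemma ex_sequence_from_history:
  fixes B :: "'a list \<Rightarrow> 'a"
  shows "\<exists>r :: nat \<Rightarrow> 'a. \<forall>n. r n = B (map r [0..<n])"
proof -
  define H where "H = rec_nat [] (\<lambda>_ h. h @ [B h])"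
  define r where "r n = B (H n)" for n
  have "map r [0..<n] = H n" for n
    by (induction n) (simp_all add: H_def r_def)
  then show ?thesis by (metis r_def)
qed

lemma legal_response_neq: "legal_response t q a \<Longrightarrow> q \<noteq> t"
  by (auto simp: legal_response_def elim: claim_true.elims)

lemma ex_legal_response:
  assumes "length q = length t" "q \<noteq> t"
  shows "\<exists>a. legal_response t q a"
proof -
  obtain i where i: "i < length q" "q ! i \<noteq> t ! i"
    using assms by (metis nth_equalityI)
  have "legal_response t q (replicate (length q) (if t ! i < q ! i then Less else Greater))"
    using i by (auto simp: legal_response_def intro!: exI[of _ i])
  then show ?thesis by blast
qed

text \<open>A finite list of responses suffices: after the \<open>k\<close> rounds of
  \<open>as\<close>, any legal response continues the play, and one exists as long as the query
  differs from \<open>t\<close>. Legality in the first \<open>k\<close> rounds certifies that these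
  queries miss \<open>t\<close>.\<close>

lemma legal_responses_refute_finds_within:
  assumes \<sigma>: "\<And>h. \<sigma> h \<in> grid ns" and t: "t \<in> grid ns"
    and as: "length as = k" "\<And>j. j < k \<Longrightarrow> legal_response t (\<sigma> (take j as)) (as ! j)"
  shows "\<not> finds_within ns \<sigma> k"
proof -
  define B where "B h = (if length h < k then as ! length h else SOME a. legal_response t (\<sigma> h) a)" for h
  obtain r where r: "\<And>n. r n = B (map r [0..<n])"
    using ex_sequence_from_history[of B] by blast
  have r_less: "r j = as ! j" if "j < k" for j
    using that by (subst r) (simp add: B_def)
  have query_less: "query \<sigma> r j = \<sigma> (take j as)" if "j < k" for j
  proof -
    have "map r [0..<j] = take j as"
      using that as(1) by (intro nth_equalityI) (simp_all add: r_less)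
    then show ?thesis by (simp add: query_def)
  qed
  have "legal_play \<sigma> t r"
    unfolding legal_play_def
  proof (intro allI impI)
    fix j assume ne: "query \<sigma> r j \<noteq> t"
    show "legal_response t (query \<sigma> r j) (r j)"
    proof (cases "j < k")
      case True
      then show ?thesis using as(2) r_less query_less by simp
    next
      case False
      have "length (query \<sigma> r j) = length t"
        using \<sigma>[of "map r [0..<j]"] t by (simp add: query_def grid_def)
      from someI_ex[OF ex_legal_response[OF this ne]]
      show ?thesis using False unfolding r[of j] by (simp add: B_def query_def)
    qed
  qed
  moreover have "query \<sigma> r j \<noteq> t" if "j < k" for j
    using legal_response_neq as(2) query_less that by metis
  ultimately show ?thesis using t unfolding finds_within_def by blast
qed

section \<open>The adversary\<close>

text \<open>The bit length of \<open>m\<close>, that is, the worst-case number of queries of a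
  binary search among \<open>m\<close> ordered candidates: a query at the median leaves up to
  \<open>m div 2\<close> of them.\<close>

fun search_cost :: "nat \<Rightarrow> nat" where
  "search_cost m = (if m = 0 then 0 else Suc (search_cost (m div 2)))"

declare search_cost.simps [simp del]

lemma search_cost_0 [simp]: "search_cost 0 = 0"
  by (simp add: search_cost.simps)

lemma search_cost_mono: "m \<le> n \<Longrightarrow> search_cost m \<le> search_cost n"
proof (induction n arbitrary: m rule: less_induct)
  case (less n)
  show ?case
  proof (cases "m = 0")
    case False
    then have "search_cost (m div 2) \<le> search_cost (n div 2)"
      using less by (simp add: div_le_mono)
    then show ?thesis
      using False less.prems by (simp add: search_cost.simps[of m] search_cost.simps[of n])
  qed simp
qed

text \<open>The hypothesis describes one query: it removes its own point and the smaller of the two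
  sides, while \<open>n\<close> candidates are kept.\<close>

lemma search_cost_le_Suc:
  assumes "m \<le> 2 * n + 1"
  shows "search_cost m \<le> Suc (search_cost n)"
proof -
  have "m div 2 \<le> n" using assms by simp
  from search_cost_mono[OF this] show ?thesis by (simp add: search_cost.simps[of m])
qed

lemma search_cost_power_2 [simp]: "search_cost (2 ^ k) = Suc k"
proof (induction k)
  case (Suc k)
  then show ?case by (simp add: search_cost.simps[of "2 * 2 ^ k"])
qed (simp add: search_cost.simps[of "Suc 0"])

section \<open>Candidates that survive all responses\<close>

lemma legal_response_3:
  "legal_response [x', a', b'] [x, a, b] [c1, c2, c3] \<longleftrightarrow>
     claim_true c1 x' x \<or> claim_true c2 a' a \<or> claim_true c3 b' b"
  by (auto simp: legal_response_def less_Suc_eq nth_Cons' split: if_splits)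

text \<open>\<open>U p\<close> is the set of candidates left in row \<open>p\<close>. The sum of the
  search costs is a potential that drops by at most one per query, so a candidate remains after
  \<open>k\<close> queries. The history \<open>h\<close> is arbitrary so that the induction can
  proceed from the middle of a game.\<close>

lemma adversary_survives:
  fixes U :: "nat \<times> nat \<Rightarrow> nat set"
  assumes l: "mono l" and \<sigma>: "\<And>h. \<sigma> h \<in> grid [n1, n2, n3]"
    and "\<And>a b. U (a, b) \<subseteq> {l (a + b)..<l (Suc (a + b))}"
    and "k < (\<Sum>p\<in>{..<n2} \<times> {..<n3}. search_cost (card (U p)))"
  shows "\<exists>a<n2. \<exists>b<n3. \<exists>x\<in>U (a, b). \<exists>as. length as = k \<and>
    (\<forall>j<k. legal_response [x, a, b] (\<sigma> (h @ take j as)) (as ! j))"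
  using assms(3,4)
proof (induction k arbitrary: h U)
  case 0
  then obtain p where "p \<in> {..<n2} \<times> {..<n3}" "search_cost (card (U p)) \<noteq> 0"
    by (metis (no_types, lifting) less_irrefl sum.neutral)
  then obtain a b where "a < n2" "b < n3" "search_cost (card (U (a, b))) \<noteq> 0"
    by auto
  moreover from this have "U (a, b) \<noteq> {}" by auto
  ultimately show ?case by auto
next
  case (Suc k)
  let ?R = "{..<n2} \<times> {..<n3}"
  obtain x a b where q: "\<sigma> h = [x, a, b]" and ab: "a < n2" "b < n3"
    using \<sigma>[of h] by (auto simp: grid_def length_Suc_conv less_Suc_eq nth_Cons')
  define s where "s = a + b"
  let ?lt = "U (a, b) \<inter> {..<x}" and ?gt = "U (a, b) \<inter> {x<..}"
  have Uab: "U (a, b) \<subseteq> {l s..<l (Suc s)}" using Suc.prems(1) by (simp add: s_def)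
  then have fin: "finite (U (a, b))" by (rule finite_subset) simp
  have "U (a, b) \<subseteq> insert x (?lt \<union> ?gt)" by auto
  then have "card (U (a, b)) \<le> card (insert x (?lt \<union> ?gt))" using fin by (intro card_mono) auto
  also have "\<dots> \<le> Suc (card ?lt + card ?gt)"
    using card_Un_le[of ?lt ?gt] fin by (simp add: card_insert_if)
  finally have card_U: "card (U (a, b)) \<le> Suc (card ?lt + card ?gt)" .
  \<comment> \<open>\<open>Y\<close> is the larger side of the queried row, and \<open>c\<close> is
    legal for every remaining candidate of every row. If \<open>x\<close> lies outside the block of
    diagonal \<open>s\<close>, one side is empty and the case split picks the other; this yields
    \<open>x < l (Suc s)\<close> in the first case and \<open>l s \<le> x\<close> in the second, as
    legality of \<open>c\<close> requires.\<close>
  obtain Y c where Y: "Y \<subseteq> U (a, b)" "card (U (a, b)) \<le> 2 * card Y + 1"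
    and c: "\<And>x' a' b'. x' \<in> (U((a, b) := Y)) (a', b') \<Longrightarrow> legal_response [x', a', b'] [x, a, b] c"
  proof (cases "x < l s \<or> x < l (Suc s) \<and> card ?lt \<le> card ?gt")
    case True
    then have "x < l (Suc s)" using l by (meson le_SucI less_le_trans monoD order_refl)
    have "card ?lt \<le> card ?gt"
    proof (cases "x < l s")
      case True
      then have "?lt = {}" using Uab by fastforce
      then show ?thesis by simp
    qed (use True in simp)
    moreover have "legal_response [x', a', b'] [x, a, b] [Greater, Less, Less]"
      if "x' \<in> (U((a, b) := ?gt)) (a', b')" for x' a' b'
    proof -
      \<comment> \<open>Outside this orthant one of the two \<open>Less\<close> claims is true.
        Inside it, every other row is on a later diagonal, whose block lies to the right of
        \<open>x\<close>.\<close>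
      have "x < x'" if "a \<le> a'" "b \<le> b'" "(a', b') \<noteq> (a, b)"
      proof -
        have "Suc s \<le> a' + b'" using that by (auto simp: s_def)
        then have "l (Suc s) \<le> l (a' + b')" using l by (simp add: monoD)
        moreover have "l (a' + b') \<le> x'"
          using Suc.prems(1)[of a' b'] that \<open>x' \<in> _\<close> by auto
        ultimately show ?thesis using \<open>x < l (Suc s)\<close> by simp
      qed
      then show ?thesis
        using that by (cases "a \<le> a' \<and> b \<le> b'") (auto simp: legal_response_3 split: if_splits)
    qed
    ultimately show ?thesis using card_U by (intro that[of ?gt "[Greater, Less, Less]"]) auto
  next
    case False
    then have "l s \<le> x" by simp
    have "card ?gt \<le> card ?lt"
    proof (cases "l (Suc s) \<le> x")
      case True
      then have "?gt = {}" using Uab by fastforce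
      then show ?thesis by simp
    qed (use False in simp)
    moreover have "legal_response [x', a', b'] [x, a, b] [Less, Greater, Greater]"
      if "x' \<in> (U((a, b) := ?lt)) (a', b')" for x' a' b'
    proof -
      have "x' < x" if "a' \<le> a" "b' \<le> b" "(a', b') \<noteq> (a, b)"
      proof -
        have "Suc (a' + b') \<le> s" using that by (auto simp: s_def)
        then have "l (Suc (a' + b')) \<le> l s" using l by (simp add: monoD)
        moreover have "x' < l (Suc (a' + b'))"
          using Suc.prems(1)[of a' b'] that \<open>x' \<in> _\<close> by auto
        ultimately show ?thesis using \<open>l s \<le> x\<close> by simp
      qed
      then show ?thesis
        using that by (cases "a' \<le> a \<and> b' \<le> b") (auto simp: legal_response_3 split: if_splits)
    qed
    ultimately show ?thesis using card_U by (intro that[of ?lt "[Less, Greater, Greater]"]) auto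
  qed
  let ?V = "U((a, b) := Y)"
  have sub: "?V p \<subseteq> U p" for p using Y(1) by simp
  have in_R: "(a, b) \<in> ?R" using ab by simp
  have "(\<Sum>p\<in>?R. search_cost (card (U p))) =
      search_cost (card (U (a, b))) + (\<Sum>p\<in>?R - {(a, b)}. search_cost (card (U p)))"
    using in_R by (intro sum.remove) auto
  also have "\<dots> \<le> Suc (search_cost (card (?V (a, b)))) + (\<Sum>p\<in>?R - {(a, b)}. search_cost (card (?V p)))"
    using search_cost_le_Suc[OF Y(2)] by (intro add_mono) (auto intro!: sum_mono)
  also have "\<dots> = Suc (\<Sum>p\<in>?R. search_cost (card (?V p)))"
    using sum.remove[OF _ in_R, of "\<lambda>p. search_cost (card (?V p))"] by simp
  finally have "k < (\<Sum>p\<in>?R. search_cost (card (?V p)))" using Suc.prems(2) by linarith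
  moreover have "?V (a', b') \<subseteq> {l (a' + b')..<l (Suc (a' + b'))}" for a' b'
    using sub Suc.prems(1) by (rule subset_trans)
  ultimately obtain a' b' x' as where t: "a' < n2" "b' < n3" "x' \<in> ?V (a', b')" "length as = k"
    and legal: "\<And>j. j < k \<Longrightarrow> legal_response [x', a', b'] (\<sigma> ((h @ [c]) @ take j as)) (as ! j)"
    using Suc.IH[of ?V "h @ [c]"] by blast
  have "legal_response [x', a', b'] (\<sigma> (h @ take j (c # as))) ((c # as) ! j)" if "j < Suc k" for j
    using that legal c[OF t(3)] by (cases j) (simp_all add: q)
  moreover have "x' \<in> U (a', b')" using t(3) sub by blast
  ultimately show ?case using t(1,2,4) by (metis length_Cons)
qed

text \<open>\<open>w s\<close> is the interval length for the diagonal \<open>a + b = s\<close>.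
  There are \<open>n2 + n3 - 1\<close> diagonals, and their consecutive intervals have to fit into
  the first coordinate. If the total cost exceeded \<open>qc\<close>, a candidate would survive an
  optimal strategy.\<close>

lemma qc_ge_sum_search_cost:
  fixes w :: "nat \<Rightarrow> nat"
  assumes pos: "0 < n1" "0 < n2" "0 < n3" and w: "(\<Sum>s<n2 + n3 - 1. w s) \<le> n1"
  shows "(\<Sum>p\<in>{..<n2} \<times> {..<n3}. search_cost (w (fst p + snd p))) \<le> qc [n1, n2, n3]"
proof (rule ccontr)
  assume less: "\<not> ?thesis"
  define l where "l s = (\<Sum>i<s. w i)" for s
  define U where "U = (\<lambda>(a, b). {l (a + b)..<l (Suc (a + b))})"
  have l: "mono l" unfolding l_def by (intro monoI sum_mono2) auto
  have card_U: "card (U p) = w (fst p + snd p)" for p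
    by (simp add: U_def l_def split: prod.split)
  obtain \<sigma> where \<sigma>: "\<And>h. \<sigma> h \<in> grid [n1, n2, n3]"
    and finds: "finds_within [n1, n2, n3] \<sigma> (qc [n1, n2, n3])"
    using qc_attained[of "[n1, n2, n3]"] pos by auto
  have "\<exists>a<n2. \<exists>b<n3. \<exists>x\<in>U (a, b). \<exists>as. length as = qc [n1, n2, n3] \<and>
    (\<forall>j<qc [n1, n2, n3]. legal_response [x, a, b] (\<sigma> ([] @ take j as)) (as ! j))"
    using less by (intro adversary_survives[OF l \<sigma>]) (simp_all add: U_def card_U[unfolded U_def])
  then obtain a b x as where t: "a < n2" "b < n3" "x \<in> U (a, b)"
    and as: "length as = qc [n1, n2, n3]"
      "\<And>j. j < qc [n1, n2, n3] \<Longrightarrow> legal_response [x, a, b] (\<sigma> (take j as)) (as ! j)"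
    by auto
  have "x < l (Suc (a + b))" using t by (simp add: U_def)
  also have "\<dots> \<le> l (n2 + n3 - 1)" using l t by (intro monoD[OF l]) simp
  also have "\<dots> \<le> n1" using w by (simp add: l_def)
  finally have "[x, a, b] \<in> grid [n1, n2, n3]"
    using t by (simp add: grid_def less_Suc_eq nth_Cons' split: if_splits)
  from legal_responses_refute_finds_within[OF \<sigma> this as] finds show False by blast
qed

section \<open>Choice of the interval lengths\<close>

text \<open>The triangle \<open>i + j < m\<close> has \<open>m * (m + 1) / 2\<close> points. The
  injection \<open>f\<close> lets this count serve two opposite corners of a rectangle.\<close>

lemma card_corner_le:
  fixes A :: "(nat \<times> nat) set"
  assumes inj: "inj_on f A" and img: "\<And>p. p \<in> A \<Longrightarrow> fst (f p) + snd (f p) < (m::nat)"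
  shows "2 * card A \<le> m * (m + 1)"
proof -
  let ?T = "SIGMA i:{..<m}. {..<m - i :: nat}"
  have "card A \<le> card ?T"
  proof (rule card_inj_on_le[OF inj])
    have "f p \<in> ?T" if "p \<in> A" for p
      using img[OF that] by (cases "f p") auto
    then show "f ` A \<subseteq> ?T" by blast
  qed simp
  also have "card ?T = (\<Sum>i<m. m - i)" by simp
  finally have "2 * card A \<le> 2 * (\<Sum>i<m. m - i)" by simp
  also have "(\<Sum>i<m. m - i) = (\<Sum>i<m. Suc i)"
    by (subst sum.nat_diff_reindex[symmetric]) (auto intro!: sum.cong)
  also have "2 * (\<Sum>i<m. Suc i) = m * (m + 1)" by (induction m) auto
  finally show ?thesis .
qed

text \<open>All intervals get length \<open>e + 1\<close>, except that \<open>K\<close> diagonals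
  are shortened by one to meet the space bound. These are split evenly between the two ends, where
  diagonals are short, so at most about \<open>K\<^sup>2 / 4\<close> rows lose one query
  each.\<close>

lemma qc_ge_longest_diagonals:
  fixes e K :: nat
  assumes pos: "0 < n1" "0 < n2" "0 < n3" and e: "e \<le> 1"
    and K: "K \<le> n2 + n3 - 1" "(e + 1) * (n2 + n3 - 1) \<le> n1 + K"
  shows "real (qc [n1, n2, n3]) \<ge> (real e + 1) * real n2 * real n3 - (real K + 1)\<^sup>2 / 4"
proof -
  define P where "P = n2 + n3 - 1"
  define K1 K2 where "K1 = K div 2" and "K2 = K - K div 2"
  let ?R = "{..<n2} \<times> {..<n3}"
  let ?A = "{p \<in> ?R. fst p + snd p < K1}" and ?B = "{p \<in> ?R. P - K2 \<le> fst p + snd p}"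
  define w where "w s = e + (if K1 \<le> s \<and> s < P - K2 then 1 else 0)" for s
  have K12: "K1 + K2 = K" by (simp add: K1_def K2_def)
  have "{..<P} \<inter> {s. K1 \<le> s \<and> s < P - K2} = {K1..<P - K2}" by auto
  then have "(\<Sum>s<P. w s) = e * P + (P - K2 - K1)"
    by (simp add: w_def sum.distrib sum.If_cases)
  also have "\<dots> \<le> n1" using K K12 by (simp add: P_def)
  finally have "(\<Sum>s<n2 + n3 - 1. w s) \<le> n1" by (simp add: P_def)
  then have qc: "(\<Sum>p\<in>?R. search_cost (w (fst p + snd p))) \<le> qc [n1, n2, n3]"
    using pos qc_ge_sum_search_cost by blast
  \<comment> \<open>Here \<open>e \<le> 1\<close> matters: the lengths are at most 2, and 0, 1 and 2
    are their own search costs.\<close>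
  have cost: "search_cost (w s) = w s" for s
    using e search_cost_power_2[of 0] search_cost_power_2[of 1]
    by (auto simp: w_def le_Suc_eq numeral_2_eq_2)
  have A: "2 * card ?A \<le> K1 * (K1 + 1)"
    by (rule card_corner_le[of id]) auto
  have B: "2 * card ?B \<le> K2 * (K2 + 1)"
  proof (rule card_corner_le[of "\<lambda>p. (n2 - 1 - fst p, n3 - 1 - snd p)"])
    show "inj_on (\<lambda>p. (n2 - 1 - fst p, n3 - 1 - snd p)) ?B"
      by (auto simp: inj_on_def)
  qed (use K K12 in \<open>auto simp: P_def\<close>)
  have "(e + 1) * (n2 * n3) = (\<Sum>p\<in>?R. e + 1)" by (simp add: card_cartesian_product)
  also have "\<dots> \<le> (\<Sum>p\<in>?R. w (fst p + snd p) + of_bool (p \<in> ?A) + of_bool (p \<in> ?B))"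
    by (intro sum_mono) (auto simp: w_def)
  also have "\<dots> = (\<Sum>p\<in>?R. w (fst p + snd p)) + card ?A + card ?B"
    by (simp add: sum.distrib Int_def conj_commute conj_left_commute)
  also have "\<dots> \<le> qc [n1, n2, n3] + card ?A + card ?B" using qc by (simp add: cost)
  finally have main: "(e + 1) * (n2 * n3) \<le> qc [n1, n2, n3] + card ?A + card ?B" .
  have "2 * (K1 * (K1 + 1) + K2 * (K2 + 1)) \<le> (K + 1)\<^sup>2"
    by (cases "even K") (auto simp: K1_def K2_def power2_eq_square elim!: evenE oddE)
  \<comment> \<open>Variables stand for the products, which keeps the arithmetic linear.\<close>
  moreover have "4 * X \<le> 4 * Q + S"
    if "2 * (C + D) \<le> S" "X \<le> Q + a + b" "2 * a \<le> C" "2 * b \<le> D" for a b C D Q S X :: nat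
    using that by simp
  ultimately have "4 * ((e + 1) * (n2 * n3)) \<le> 4 * qc [n1, n2, n3] + (K + 1)\<^sup>2"
    using main A B by blast
  then have "real (4 * ((e + 1) * (n2 * n3))) \<le> real (4 * qc [n1, n2, n3] + (K + 1)\<^sup>2)"
    by (rule of_nat_mono)
  then show ?thesis by (simp add: algebra_simps)
qed

text \<open>Intervals of length \<open>2 ^ k\<close> cost \<open>k + 1\<close> per row. By
  \<open>n3 \<le> n2\<close>, the space allows this length on all diagonals but one, with one value
  left over. Diagonal 0 gets that value; it consists of the single row \<open>(0, 0)\<close>, so the
  loss is only \<open>k\<close>.\<close>

lemma qc_ge_power_2_intervals:
  fixes k :: nat
  assumes "2 \<le> n3" "n3 \<le> n2" "2 ^ (k + 1) * (n2 - 1) \<le> n1 - 1" "0 < n1"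
  shows "(k + 1) * n2 * n3 \<le> qc [n1, n2, n3] + k"
proof -
  let ?R = "{..<n2} \<times> {..<n3}"
  define w :: "nat \<Rightarrow> nat" where "w s = (if s = 0 then 1 else 2 ^ k)" for s
  have "n2 + n3 - 1 = Suc (n2 + n3 - 2)" using assms by simp
  then have "(\<Sum>s<n2 + n3 - 1. w s) = 1 + (n2 + n3 - 2) * 2 ^ k"
    by (simp only: sum.lessThan_Suc_shift) (simp add: w_def)
  also have "\<dots> \<le> 1 + (2 * (n2 - 1)) * 2 ^ k"
    using assms by (intro add_left_mono mult_right_mono) auto
  also have "\<dots> \<le> n1" using assms by (simp add: mult_ac)
  finally have "(\<Sum>p\<in>?R. search_cost (w (fst p + snd p))) \<le> qc [n1, n2, n3]"
    using assms by (intro qc_ge_sum_search_cost) auto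
  moreover have "(\<Sum>p\<in>?R. k + 1) \<le> (\<Sum>p\<in>?R. search_cost (w (fst p + snd p)) + (if p = (0, 0) then k else 0))"
    using search_cost_power_2[of 0] by (intro sum_mono) (auto simp: w_def)
  moreover have "(\<Sum>p\<in>?R. k + 1) = (k + 1) * n2 * n3"
    by (simp add: card_cartesian_product algebra_simps)
  moreover have "(\<Sum>p\<in>?R. if p = (0, 0) then k else 0) = k"
    using assms by simp
  ultimately show ?thesis by (simp only: sum.distrib)
qed

section \<open>Linear bounds on the binary logarithm\<close>

lemma log2_le_half:
  assumes "0 < c" "c \<le> 2"
  shows "log 2 c \<le> c / 2"
proof -
  have "ln (c / 2) \<le> c / 2 - 1" using assms by (intro ln_le_minus_one) simp
  \<comment> \<open>The factor \<open>c / 2 - 1\<close> is nonpositive, and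
    \<open>ln 2 < 1\<close>.\<close>
  also have "\<dots> \<le> (c / 2 - 1) * ln 2"
    using assms ln_2_less_1 mult_left_mono_neg[of "ln 2" 1 "c / 2 - 1"] by simp
  finally have "ln c \<le> c / 2 * ln 2" using assms by (simp add: ln_div algebra_simps)
  then show ?thesis by (simp add: log_def field_simps)
qed

lemma log2_le_minus_one:
  assumes "2 \<le> c"
  shows "log 2 c \<le> c - 1"
proof -
  have "ln (c / 2) \<le> c / 2 - 1" using assms by (intro ln_le_minus_one) simp
  also have "\<dots> = (c - 2) * (1 / 2)" by simp
  \<comment> \<open>\<open>ln 2 \<ge> 1 / 2\<close> is \<open>ln z \<le> z - 1\<close> at
    \<open>z = 1 / 2\<close>.\<close>
  also have "\<dots> \<le> (c - 2) * ln 2"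
    using assms ln_le_minus_one[of "1 / 2"] by (intro mult_left_mono) (auto simp: ln_div)
  finally have "ln c \<le> (c - 1) * ln 2" using assms by (simp add: ln_div algebra_simps)
  then show ?thesis by (simp add: log_def field_simps)
qed

section \<open>Comparison of the query bounds with the logarithmic bound\<close>

theorem theorem2:
  fixes n1 n2 n3 :: nat
  assumes "n1 \<ge> n2" and "n2 \<ge> n3" and "n3 \<ge> 2"
  shows "real (qc [n1, n2, n3]) \<ge>
    1 / 2 * (real n2 - 1) * real n3 * (log 2 ((real n1 - 1) / (real n2 - 1)) + 1)"
proof -
  define M N y where "M = real n2 - 1" and "N = real n1 - 1" and "y = real n3"
  define L where "L = log 2 (N / M)"
  have M: "1 \<le> M" and N: "M \<le> N" and y: "2 \<le> y" "y \<le> M + 1"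
    using assms by (auto simp: M_def N_def y_def)
  have L_le: "L \<le> real j" if "N \<le> 2 ^ j * M" for j
  proof -
    have "log 2 (N / M) \<le> log 2 (2 ^ j)"
      using that M N by (intro log_mono) (auto simp: field_simps)
    then show ?thesis by (simp add: L_def)
  qed
  \<comment> \<open>In the first case \<open>e\<close> is the length of the shortened intervals; the
    second case uses powers of two.\<close>
  consider e :: nat where "e = 0 \<and> N \<le> 2 * M \<or> e = 1 \<and> 2 * M \<le> N \<and> N \<le> 4 * M" | "4 * M \<le> N"
    using linorder_le_cases by metis
  then have "M * y * (L + 1) / 2 \<le> real (qc [n1, n2, n3])"
  proof cases
    case (1 e)
    have e: "e \<le> 1" "(real e + 1) * M \<le> N" using 1 N by auto
    have L: "L \<le> real (e + 1)" using 1 by (intro L_le) auto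
    define P where "P = n2 + n3 - 1"
    \<comment> \<open>The number of diagonals that must be shortened; truncated subtraction gives 0
      if length \<open>e + 1\<close> fits everywhere.\<close>
    define K where "K = (e + 1) * P - n1"
    have P: "real P = M + y" using assms by (simp add: P_def M_def y_def)
    have "real (e * P) \<le> real n1"
      using 1 N y M by (auto simp: P N_def)
    then have "e * P \<le> n1" by linarith
    then have "K \<le> P" "(e + 1) * P \<le> n1 + K" by (auto simp: K_def)
    then have "(real e + 1) * real n2 * real n3 - (real K + 1)\<^sup>2 / 4 \<le> real (qc [n1, n2, n3])"
      using assms e unfolding P_def by (intro qc_ge_longest_diagonals) auto
    then have qc: "(real e + 1) * (M + 1) * y - (real K + 1)\<^sup>2 / 4 \<le> real (qc [n1, n2, n3])"
      by (simp add: M_def y_def)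
    show ?thesis
    proof (cases "K = 0")
      case True
      have "M * y * (L + 1) / 2 \<le> M * y * (real e + 1)"
        using L M y mult_left_mono[of "(L + 1) / 2" "real e + 1" "M * y"] by simp
      \<comment> \<open>The surplus from \<open>M + 1\<close> in place of \<open>M\<close> pays for
        the loss of \<open>1 / 4\<close>.\<close>
      moreover have "1 * y \<le> (real e + 1) * y" using y by (intro mult_right_mono) auto
      moreover have "(real e + 1) * (M + 1) * y = M * y * (real e + 1) + (real e + 1) * y"
        by (simp add: algebra_simps)
      moreover have "(real K + 1)\<^sup>2 = 1" using True by simp
      ultimately show ?thesis using qc y by linarith
    next
      case False
      define u where "u = real K + 1"
      have "real K = real ((e + 1) * P) - real n1"
        using False unfolding K_def by (intro of_nat_diff) simp
      then have u: "u = (real e + 1) * (M + y) - N" by (simp add: u_def P N_def algebra_simps)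
      \<comment> \<open>Two bounds on \<open>u\<close>: one is a multiple of \<open>y\<close>, the
        other is free of \<open>y\<close>. Bounding \<open>u * u\<close> by their product lets a
        factor \<open>y\<close> be split off, which leaves an inequality in \<open>M\<close>,
        \<open>N\<close> and \<open>L\<close>.\<close>
      have "u \<le> (real e + 1) * y" using u e by (simp add: algebra_simps)
      moreover have "u \<le> (real e + 1) * (2 * M + 1) - N"
        using u y mult_left_mono[of y "M + 1" "real e + 1"] by (simp add: algebra_simps)
      moreover have "0 \<le> u" by (simp add: u_def)
      ultimately have "u * u \<le> ((real e + 1) * y) * ((real e + 1) * (2 * M + 1) - N)"
        by (intro mult_mono) auto
      moreover have "(real e + 1) * (M + 1) * y - u * u / 4 \<le> real (qc [n1, n2, n3])"
        using qc by (simp add: u_def power2_eq_square)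
      ultimately have qc': "y * ((real e + 1) * (M + 1) - (real e + 1) * ((real e + 1) * (2 * M + 1) - N) / 4)
          \<le> real (qc [n1, n2, n3])"
        by (simp add: field_simps)
      have "M * (L + 1) / 2 \<le> (real e + 1) * (M + 1) - (real e + 1) * ((real e + 1) * (2 * M + 1) - N) / 4"
        using 1
      proof
        assume "e = 0 \<and> N \<le> 2 * M"
        \<comment> \<open>With this bound, and with \<open>N / M - 1\<close> for
          \<open>e = 1\<close>, the terms in \<open>M\<close> and \<open>N\<close> on both sides
          agree and a positive constant is left over.\<close>
        moreover from this have "L \<le> N / M / 2"
          unfolding L_def using M N by (intro log2_le_half) (auto simp: field_simps)
        ultimately show ?thesis using M by (simp add: field_simps)
      next
        assume "e = 1 \<and> 2 * M \<le> N \<and> N \<le> 4 * M"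
        moreover from this have "L \<le> N / M - 1"
          unfolding L_def using M N by (intro log2_le_minus_one) (auto simp: field_simps)
        ultimately show ?thesis using M by (simp add: field_simps)
      qed
      from order_trans[OF mult_left_mono[OF this, of y] qc'] show ?thesis
        using y by (simp add: mult_ac)
    qed
  next
    case 2
    have "log 2 (2 ^ 2) \<le> L" unfolding L_def using 2 M by (intro log_mono) (auto simp: field_simps)
    then have L2: "2 \<le> L" using log_pow_cancel[of 2 2] by simp
    \<comment> \<open>The largest \<open>k\<close> with \<open>2 ^ (k + 1) \<le> N / M\<close>.
      Since \<open>k \<ge> 1\<close>, the bound \<open>L \<le> k + 2\<close> gives
      \<open>(L + 1) / 2 \<le> k + 1\<close>.\<close>
    define k where "k = nat \<lfloor>L\<rfloor> - 1"
    have k: "real k + 1 \<le> L" "L \<le> real k + 2" "1 \<le> k" using L2 by (auto simp: k_def) linarith+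
    have "(2::real) ^ (k + 1) = 2 powr (real k + 1)" by (simp add: powr_add powr_realpow)
    also have "\<dots> \<le> 2 powr L" using k by simp
    also have "\<dots> = N / M" using M N by (simp add: L_def)
    finally have "2 ^ (k + 1) * M \<le> N" using M by (simp add: field_simps)
    then have "real (2 ^ (k + 1) * (n2 - 1)) \<le> real (n1 - 1)"
      using assms by (simp add: M_def N_def)
    then have "2 ^ (k + 1) * (n2 - 1) \<le> n1 - 1" by (simp only: of_nat_le_iff)
    then have "(k + 1) * n2 * n3 \<le> qc [n1, n2, n3] + k"
      using assms by (intro qc_ge_power_2_intervals) auto
    then have "real ((k + 1) * n2 * n3) \<le> real (qc [n1, n2, n3] + k)" by (rule of_nat_mono)
    then have qc: "(real k + 1) * (M + 1) * y \<le> real (qc [n1, n2, n3]) + real k"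
      by (simp add: M_def y_def algebra_simps)
    have "M * y * (L + 1) / 2 \<le> M * y * (real k + 1)"
      using k M y mult_left_mono[of "(L + 1) / 2" "real k + 1" "M * y"] by simp
    \<comment> \<open>The loss \<open>k\<close> at row \<open>(0, 0)\<close> is again covered by the
      surplus from \<open>M + 1\<close>.\<close>
    moreover have "real k * 1 \<le> (real k + 1) * y" using y by (intro mult_mono) auto
    ultimately show ?thesis using qc by (simp add: algebra_simps)
  qed
  then show ?thesis by (simp add: M_def N_def y_def L_def)
qed

end
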